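(* Let $H_0,H_1$ be real Hilbert spaces and let $G_0\colon\operatorname{dom}(G_0)\subseteq H_0\to H_1$, $D_0\colon\operatorname{dom}(D_0)\subseteq H_1\to H_0$ be closed, densely defined linear operators such that $G:=-D_0^*\supseteq G_0$ and $D:=-G_0^*\supseteq D_0$. Let $$A=\begin{pmatrix} 0 & D \\ G & 0 \end{pmatrix}$$ on $H=H_0\oplus H_1$ with $\operatorname{dom}(A)=\operatorname{dom}(G)\times\operatorname{dom}(D)$, and let $C\subseteq A$ be a (not necessarily linear) restriction of $A$. Then the following statements are equivalent: (i) $C$ is $m$-accretive; (ii) there exists $h\colon\ker(1-A)\to\ker(1+A)$ with $|h|_{\mathrm{Lip}}\le1$ (Lipschitz seminorm with respect to the norm of $H$) such that $\operatorname{dom}(C)=\{x\in\operatorname{dom}(A)\,;\,h(\pi_1x)=\pi_{-1}x\}$; (iii) there exists $f\colon\mathcal{BD}(G)\to\mathcal{BD}(G)$ with $|f|_{\mathrm{Lip}}\le1$ (Lipschitz seminorm with respect to the norm of $\mathcal{BD}(G)$) such that $$\operatorname{dom}(C)=\{(u,v)\in\operatorname{dom}(A)\,;\,f(\tfrac12(u_{\mathcal{BD}}+Dv_{\mathcal{BD}}))=\tfrac12(u_{\mathcal{BD}}-Dv_{\mathcal{BD}})\};$$ (iv) there exists an $m$-accretive relation $M\subseteq\mathcal{BD}(G)\times\mathcal{BD}(G)$ such that $$\operatorname{dom}(C)=\{(u,v)\in\operatorname{dom}(A)\,;\,(u_{\mathcal{BD}},Dv_{\mathcal{BD}})\in M\}.$$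 In either case we have $f(u)=h_1((u,Gu))$ for $u\in\mathcal{BD}(G)$, where $h_1$ denotes the first ($H_0$-)component of $h$, and $M=2(1+f)^{-1}-1$.
   Context: All Hilbert spaces are real. Domains of closed operators carry the graph inner product. Put $A_0=\begin{pmatrix} 0 & D_0 \\ G_0 & 0 \end{pmatrix}$ with domain $\operatorname{dom}(G_0)\times\operatorname{dom}(D_0)$; it is skew-symmetric and $A=-A_0^*$. There is the graph-orthogonal decomposition $\operatorname{dom}(A)=\operatorname{dom}(A_0)\oplus\ker(1-A)\oplus\ker(1+A)$, and $\pi_1,\pi_{-1}$ are the corresponding orthogonal projections of $\operatorname{dom}(A)$ onto $\ker(1-A)$ and $\ker(1+A)$, respectively. Set $\mathcal{BD}(G):=\{u\in\operatorname{dom}(DG)\,;\,DGu=u\}$ and $\mathcal{BD}(D):=\{v\in\operatorname{dom}(GD)\,;\,GDv=v\}$. These are the orthogonal complements of $\operatorname{dom}(G_0)$ in $\operatorname{dom}(G)$ and of $\operatorname{dom}(D_0)$ in $\operatorname{dom}(D)$ (graph inner products), and are Hilbert spaces with these graph inner products; $G$ maps $\mathcal{BD}(G)$ unitarily onto $\mathcal{BD}(D)$ and $D$ maps $\mathcal{BD}(D)$ unitarily onto $\mathcal{BD}(G)$. For $u\in\operatorname{dom}(G)$, $v\in\operatorname{dom}(D)$, $u_{\mathcal{BD}}$ and $v_{\mathcal{BD}}$ denote their graph-orthogonal projections onto $\mathcal{BD}(G)$ and $\mathcal{BD}(D)$. Operators and mappings are identified with their graphs; $C\subseteq A$ means $C$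 is the restriction of $A$ to some subset $\operatorname{dom}(C)\subseteq\operatorname{dom}(A)$. A relation $B\subseteq X\times X$ on a Hilbert space $X$ is accretive if $\langle y-v,x-u\rangle_X\ge0$ for all $(u,v),(x,y)\in B$, and $m$-accretive if it is accretive and for each $g\in X$ there is $(u,v)\in B$ with $u+v=g$. $|\cdot|_{\mathrm{Lip}}$ is the smallest Lipschitz constant ($\infty$ if none exists). For a mapping $f\colon X\to X$, $2(1+f)^{-1}-1$ is understood as the relation $\{(w+f(w),w-f(w))\,;\,w\in X\}$. *)

theory Defs
  imports "HOL-Analysis.Analysis"
begin

text \<open>
  Real Hilbert spaces are types of sort \<open>{real_inner, complete_space}\<close>; the orthogonal sum of two
  such spaces is their product type. Operators are identified with their graphs, so an operator
  from \<open>'a\<close> to \<open>'b\<close> is a set of pairs, its domain is \<^const>\<open>Domain\<close>, and \<open>S \<subseteq> T\<close> says that \<open>S\<close>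
  is a restriction of \<open>T\<close>. With the argument order of \<^const>\<open>relcomp\<close>, the composition
  "\<open>T\<close> after \<open>S\<close>" is \<open>S O T\<close>.
\<close>

definition linear_op :: "('a::real_vector \<times> 'b::real_vector) set \<Rightarrow> bool" where
  "linear_op T \<longleftrightarrow> single_valued T \<and> subspace T"

definition densely_defined :: "('a::topological_space \<times> 'b) set \<Rightarrow> bool" where
  "densely_defined T \<longleftrightarrow> closure (Domain T) = UNIV"

text \<open>The value \<open>T x\<close>; meaningful for single-valued \<open>T\<close> and \<open>x \<in> Domain T\<close>.\<close>

definition app :: "('a \<times> 'b) set \<Rightarrow> 'a \<Rightarrow> 'b" where
  "app T x = (THE y. (x, y) \<in> T)"

definition adjoint_op :: "('a::real_inner \<times> 'b::real_inner) set \<Rightarrow> ('b \<times> 'a) set" where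
  "adjoint_op T = {(y, z). \<forall>(x, w) \<in> T. w \<bullet> y = x \<bullet> z}"

text \<open>The operator \<open>- T\<close> (unary minus on sets is the complement).\<close>

definition neg_op :: "('a \<times> 'b::uminus) set \<Rightarrow> ('a \<times> 'b) set" where
  "neg_op T = {(x, - y) | x y. (x, y) \<in> T}"

text \<open>The operator matrix with zero diagonal, upper right entry \<open>D\<close> and lower left entry \<open>G\<close>.\<close>

definition block_op :: "('b \<times> 'a) set \<Rightarrow> ('a \<times> 'b) set \<Rightarrow> (('a \<times> 'b) \<times> ('a \<times> 'b)) set" where
  "block_op D G = {((u, v), (x, y)). (v, x) \<in> D \<and> (u, y) \<in> G}"

definition graph_inner :: "('a::real_inner \<times> 'b::real_inner) set \<Rightarrow> 'a \<Rightarrow> 'a \<Rightarrow> real" where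
  "graph_inner T x y = x \<bullet> y + app T x \<bullet> app T y"

definition graph_norm :: "('a::real_inner \<times> 'b::real_inner) set \<Rightarrow> 'a \<Rightarrow> real" where
  "graph_norm T x = sqrt (graph_inner T x x)"

text \<open>The orthogonal projection of \<open>x\<close> onto \<open>S\<close> with respect to the inner product \<open>ip\<close>.\<close>

definition orth_proj :: "('a \<Rightarrow> 'a \<Rightarrow> real) \<Rightarrow> 'a set \<Rightarrow> 'a \<Rightarrow> 'a::real_vector" where
  "orth_proj ip S x = (THE p. p \<in> S \<and> (\<forall>s\<in>S. ip (x - p) s = 0))"

definition ker_one_minus :: "('a \<times> 'a::real_vector) set \<Rightarrow> 'a set" where
  "ker_one_minus A = {x \<in> Domain A. x - app A x = 0}"

definition ker_one_plus :: "('a \<times> 'a::real_vector) set \<Rightarrow> 'a set" where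
  "ker_one_plus A = {x \<in> Domain A. x + app A x = 0}"

text \<open>\<open>BD G D\<close> is the boundary data space of \<open>G\<close>, and \<open>BD D G\<close> that of \<open>D\<close>.\<close>

definition BD :: "('a \<times> 'b) set \<Rightarrow> ('b \<times> 'a) set \<Rightarrow> 'a set" where
  "BD S T = {x \<in> Domain (S O T). app (S O T) x = x}"

abbreviation proj_BD ::
  "('a::real_inner \<times> 'b::real_inner) set \<Rightarrow> ('b \<times> 'a) set \<Rightarrow> 'a \<Rightarrow> 'a" where
  "proj_BD S T \<equiv> orth_proj (graph_inner S) (BD S T)"

text \<open>
  Accretivity on a Hilbert space given by its carrier \<open>X\<close> and inner product \<open>ip\<close>; this also covers
  boundary data spaces, which carry a graph inner product.
\<close>

definition accretive_on :: "'a::real_vector set \<Rightarrow> ('a \<Rightarrow> 'a \<Rightarrow> real) \<Rightarrow> ('a \<times> 'a) set \<Rightarrow> bool" where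
  "accretive_on X ip B \<longleftrightarrow>
     B \<subseteq> X \<times> X \<and> (\<forall>(u, v) \<in> B. \<forall>(x, y) \<in> B. ip (y - v) (x - u) \<ge> 0)"

definition m_accretive_on :: "'a::real_vector set \<Rightarrow> ('a \<Rightarrow> 'a \<Rightarrow> real) \<Rightarrow> ('a \<times> 'a) set \<Rightarrow> bool" where
  "m_accretive_on X ip B \<longleftrightarrow>
     accretive_on X ip B \<and> (\<forall>g\<in>X. \<exists>(u, v) \<in> B. u + v = g)"

text \<open>
  The smallest Lipschitz constant of \<open>f\<close> on \<open>X\<close>, for the norms \<open>nX\<close> and \<open>nY\<close>; it is \<open>\<infinity>\<close>, the
  infimum of the empty set, if there is no Lipschitz constant.
\<close>

definition lip_seminorm ::
  "('a::real_vector \<Rightarrow> real) \<Rightarrow> ('b::real_vector \<Rightarrow> real) \<Rightarrow> 'a set \<Rightarrow> ('a \<Rightarrow> 'b) \<Rightarrow> ereal" where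
  "lip_seminorm nX nY X f =
     Inf {ereal L | L. L \<ge> 0 \<and> (\<forall>x\<in>X. \<forall>y\<in>X. nY (f x - f y) \<le> L * nX (x - y))}"

text \<open>
  The three ways in which a map \<open>h\<close>, a map \<open>f\<close> and a relation \<open>M\<close> can describe the domain of a
  restriction \<open>C\<close> of \<open>block_op D G\<close>.
\<close>

definition describes_ker ::
  "(('a::real_inner) \<times> 'a) set \<Rightarrow> ('a \<times> 'a) set \<Rightarrow> ('a \<Rightarrow> 'a) \<Rightarrow> bool" where
  "describes_ker A C h \<longleftrightarrow>
     h \<in> ker_one_minus A \<rightarrow> ker_one_plus A \<and>
     lip_seminorm norm norm (ker_one_minus A) h \<le> 1 \<and>
     Domain C = {x \<in> Domain A. h (orth_proj (graph_inner A) (ker_one_minus A) x)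
                                = orth_proj (graph_inner A) (ker_one_plus A) x}"

definition describes_BD_map ::
  "('a::real_inner \<times> 'b::real_inner) set \<Rightarrow> ('b \<times> 'a) set \<Rightarrow>
   (('a \<times> 'b) \<times> ('a \<times> 'b)) set \<Rightarrow> ('a \<Rightarrow> 'a) \<Rightarrow> bool" where
  "describes_BD_map G D C f \<longleftrightarrow>
     f \<in> BD G D \<rightarrow> BD G D \<and>
     lip_seminorm (graph_norm G) (graph_norm G) (BD G D) f \<le> 1 \<and>
     Domain C = {(u, v). (u, v) \<in> Domain (block_op D G) \<and>
        f ((1/2) *\<^sub>R (proj_BD G D u + app D (proj_BD D G v)))
        = (1/2) *\<^sub>R (proj_BD G D u - app D (proj_BD D G v))}"

definition describes_BD_rel ::
  "('a::real_inner \<times> 'b::real_inner) set \<Rightarrow> ('b \<times> 'a) set \<Rightarrow>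
   (('a \<times> 'b) \<times> ('a \<times> 'b)) set \<Rightarrow> ('a \<times> 'a) set \<Rightarrow> bool" where
  "describes_BD_rel G D C M \<longleftrightarrow>
     m_accretive_on (BD G D) (graph_inner G) M \<and>
     Domain C = {(u, v). (u, v) \<in> Domain (block_op D G) \<and>
        (proj_BD G D u, app D (proj_BD D G v)) \<in> M}"

text \<open>The relation \<open>2 (1 + f)\<^sup>-\<^sup>1 - 1\<close> on \<open>X\<close>.\<close>

definition cayley_rel :: "'a set \<Rightarrow> ('a \<Rightarrow> 'a) \<Rightarrow> ('a \<times> 'a::real_vector) set" where
  "cayley_rel X f = {(w + f w, w - f w) | w. w \<in> X}"

end

theory Submission
  imports Defs
begin

text \<open>
  Everything that distinguishes one restriction of \<open>A\<close> from another happens in the boundary data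
  space. Send \<open>x = (u, v)\<close> in the domain of \<open>A\<close> to its boundary trace \<open>(a, b) = (u\<^sub>B\<^sub>D, D v\<^sub>B\<^sub>D)\<close>. The
  remaining parts of \<open>u\<close> and \<open>v\<close> lie in the domains of \<open>G\<^sub>0\<close> and \<open>D\<^sub>0\<close>, where \<open>D = - G\<^sub>0\<^sup>*\<close> and
  \<open>G = - D\<^sub>0\<^sup>*\<close> make their contributions cancel. So Green's formula (\<open>green\<close>) reads
  \<open>A x \<bullet> x = \<langle>a, b\<rangle>\<close> with the graph inner product of \<open>G\<close>. The trace is linear and maps onto
  pairs of boundary data (\<open>boundary_trace_lift\<close>), so a restriction whose domain is the preimage of a
  relation \<open>M\<close> between boundary data is accretive exactly if \<open>M\<close> is.

  The range condition transfers as well. The operator \<open>1 + A\<close> is onto (\<open>one_plus_A_surj\<close>), because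
  the orthogonal complement of the graph of \<open>G\<^sub>0\<close> is the flipped graph of \<open>D\<close>; and the kernel of
  \<open>1 + A\<close> consists of the vectors \<open>(w, - G w)\<close>, whose traces are the pairs \<open>(w, - w)\<close>. Hence a
  solution of \<open>x + A x = g\<close> can be moved along the antidiagonal, which preserves \<open>a + b\<close>, and it can
  be moved into the preimage of \<open>M\<close> as soon as \<open>a + b\<close> is a value of \<open>1 + M\<close>. Conversely, the domain
  of an m-accretive restriction is the full preimage of its traces: a vector \<open>x\<close> with the trace of
  some \<open>y\<close> in the domain cannot be told from \<open>y\<close> by Green's formula, and the solution \<open>z\<close> in the
  domain of \<open>z + A z = x + A x\<close> must then equal \<open>x\<close>. These are the two lemmas
  \<open>describes_BD_rel_imp_m_accretive\<close> and \<open>m_accretive_imp_describes_BD_rel\<close>.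

  The passage from relations to maps is Minty's: by polarization \<open>\<langle>a, b\<rangle> \<ge> 0\<close> says that
  \<open>a - b\<close> is no longer than \<open>a + b\<close>, so in the coordinates \<open>(a + b) / 2\<close> and \<open>(a - b) / 2\<close> an m-accretive
  relation becomes the graph of a nonexpansive map (\<open>m_accretive_cayley_rel_iff\<close>,
  \<open>m_accretive_imp_cayley_rel\<close>). These same coordinates are, up to the isometries
  \<open>w \<mapsto> (w, G w)\<close> and \<open>w \<mapsto> (w, - G w)\<close>, the projections of \<open>x\<close> onto the two eigenspaces
  of \<open>A\<close> (\<open>orth_proj_eigenspace\<close>), which translates \<open>f\<close> into \<open>h\<close>. Finally, since the trace is onto,
  the domain of \<open>C\<close> determines \<open>M\<close>, hence \<open>f\<close> on the boundary data and \<open>h\<close> on the eigenspace; this gives the two formulas.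
\<close>

section \<open>Orthogonal projections and the Lipschitz seminorm\<close>

text \<open>
  Moving from the nearest point \<open>p\<close> in the direction of \<open>s\<close> cannot decrease the distance, although a
  component of \<open>x - p\<close> along \<open>s\<close> would allow it.
\<close>

lemma nearest_point_orthogonal:
  fixes S :: "'h::real_inner set"
  assumes S: "subspace S" and p: "p \<in> S"
    and min: "\<And>s. s \<in> S \<Longrightarrow> norm (x - p) \<le> norm (x - s)" and s: "s \<in> S"
  shows "(x - p) \<bullet> s = 0"
proof (cases "s = 0")
  case False
  define c where "c = (x - p) \<bullet> s"
  have ss: "s \<bullet> s > 0" using False by simp
  \<comment> \<open>this competitor minimizes the distance to \<open>x\<close> on the line through \<open>p\<close> along \<open>s\<close>\<close>
  have "p + (c / (s \<bullet> s)) *\<^sub>R s \<in> S"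
    using S p s by (simp add: subspace_add subspace_scale)
  from min[OF this] have "norm (x - p) \<le> norm (x - p - (c / (s \<bullet> s)) *\<^sub>R s)"
    by (simp add: algebra_simps)
  then have "(norm (x - p))\<^sup>2 \<le> (norm (x - p - (c / (s \<bullet> s)) *\<^sub>R s))\<^sup>2"
    by (simp add: power_mono)
  also have "\<dots> = (norm (x - p))\<^sup>2 - 2 * (c / (s \<bullet> s)) * c + (c / (s \<bullet> s))\<^sup>2 * (s \<bullet> s)"
    unfolding power2_norm_eq_inner c_def inner_diff_left[of "x - p"] inner_diff_right[of _ "x - p"]
    by (simp add: inner_commute[of s "x - p"] power2_eq_square)
  also have "\<dots> = (norm (x - p))\<^sup>2 - c\<^sup>2 / (s \<bullet> s)"
    using ss by (simp add: field_simps power2_eq_square)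
  finally have "c\<^sup>2 / (s \<bullet> s) \<le> 0" by simp
  then have "c\<^sup>2 \<le> 0" using ss by (simp add: divide_le_0_iff)
  then show ?thesis by (simp add: c_def)
qed simp

text \<open>
  The projection theorem for a closed subspace of a Hilbert space of any dimension. By the
  parallelogram law a minimizing sequence for the distance is Cauchy, since midpoints of its members
  are again at least as far away as the infimum.
\<close>

lemma orthogonal_decomposition:
  fixes S :: "'h::{real_inner,complete_space} set"
  assumes S: "subspace S" and cl: "closed S"
  shows "\<exists>p\<in>S. \<forall>s\<in>S. (x - p) \<bullet> s = 0"
proof -
  have ne: "S \<noteq> {}" using S subspace_0 by blast
  define d where "d = infdist x S"
  have d0: "d \<ge> 0" by (simp add: d_def infdist_nonneg)
  have d_le: "d \<le> norm (x - s)" if "s \<in> S" for s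
    using infdist_le[OF that, of x] by (simp add: d_def dist_norm)
  have "\<exists>s\<in>S. (norm (x - s))\<^sup>2 < d\<^sup>2 + inverse (real (Suc n))" for n
  proof -
    have "d < sqrt (d\<^sup>2 + inverse (real (Suc n)))"
      by (rule real_less_rsqrt) simp
    then obtain s where "s \<in> S" and "dist x s < sqrt (d\<^sup>2 + inverse (real (Suc n)))"
      using iffD1[OF cINF_less_iff[OF ne bdd_below_image_dist]]
      by (metis d_def infdist_notempty[OF ne])
    then have "(norm (x - s))\<^sup>2 < (sqrt (d\<^sup>2 + inverse (real (Suc n))))\<^sup>2"
      unfolding dist_norm by (intro power_strict_mono) auto
    then show ?thesis using \<open>s \<in> S\<close> by (intro bexI[of _ s]) (simp_all add: add_nonneg_nonneg)
  qed
  then obtain \<sigma> where \<sigma>: "\<And>n. \<sigma> n \<in> S"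
    and near: "\<And>n. (norm (x - \<sigma> n))\<^sup>2 < d\<^sup>2 + inverse (real (Suc n))"
    by metis
  \<comment> \<open>the parallelogram law, where the midpoint has distance at least \<open>d\<close> from \<open>x\<close>\<close>
  have gap: "(norm (\<sigma> m - \<sigma> n))\<^sup>2 \<le> 2 * inverse (real (Suc m)) + 2 * inverse (real (Suc n))"
    for m n
  proof -
    have "(1/2) *\<^sub>R (\<sigma> m + \<sigma> n) \<in> S"
      using S \<sigma> by (simp add: subspace_add subspace_scale)
    from d_le[OF this] d0 have "d\<^sup>2 \<le> (norm (x - (1/2) *\<^sub>R (\<sigma> m + \<sigma> n)))\<^sup>2"
      by (simp add: power_mono)
    moreover have "(norm (\<sigma> m - \<sigma> n))\<^sup>2 + 4 * (norm (x - (1/2) *\<^sub>R (\<sigma> m + \<sigma> n)))\<^sup>2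
        = 2 * (norm (x - \<sigma> m))\<^sup>2 + 2 * (norm (x - \<sigma> n))\<^sup>2"
      unfolding power2_norm_eq_inner
      by (simp add: inner_diff_left inner_diff_right inner_add_left inner_add_right inner_commute
          algebra_simps)
    ultimately show ?thesis using near[of m] near[of n] by linarith
  qed
  have "Cauchy \<sigma>"
  proof (rule metric_CauchyI)
    fix e :: real assume e: "e > 0"
    then obtain N where N: "inverse (real (Suc N)) < e\<^sup>2 / 4"
      using reals_Archimedean[of "e\<^sup>2 / 4"] by auto
    have "dist (\<sigma> m) (\<sigma> n) < e" if "m \<ge> N" "n \<ge> N" for m n
    proof -
      have "inverse (real (Suc m)) \<le> inverse (real (Suc N))"
        "inverse (real (Suc n)) \<le> inverse (real (Suc N))"
        using that by (auto intro: le_imp_inverse_le)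
      then have "(norm (\<sigma> m - \<sigma> n))\<^sup>2 < e\<^sup>2" using gap[of m n] N by linarith
      then show ?thesis using e by (simp add: dist_norm power2_less_imp_less)
    qed
    then show "\<exists>M. \<forall>m\<ge>M. \<forall>n\<ge>M. dist (\<sigma> m) (\<sigma> n) < e" by blast
  qed
  then obtain p where lim: "\<sigma> \<longlonglongrightarrow> p" using Cauchy_convergent convergent_def by blast
  have p: "p \<in> S" using closed_sequentially[OF cl] \<sigma> lim by blast
  have "(\<lambda>n. (norm (x - \<sigma> n))\<^sup>2) \<longlonglongrightarrow> (norm (x - p))\<^sup>2"
    by (intro tendsto_intros lim)
  moreover have "(\<lambda>n. d\<^sup>2 + inverse (real (Suc n))) \<longlonglongrightarrow> d\<^sup>2 + 0"
    by (intro tendsto_intros LIMSEQ_inverse_real_of_nat)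
  ultimately have "(norm (x - p))\<^sup>2 \<le> d\<^sup>2 + 0"
    by (rule LIMSEQ_le) (use near in \<open>blast intro: less_imp_le\<close>)
  then have "norm (x - p) \<le> d" using d0 by (auto intro: power2_le_imp_le)
  then have "norm (x - p) \<le> norm (x - s)" if "s \<in> S" for s
    using d_le[OF that] by linarith
  then show ?thesis using nearest_point_orthogonal[OF S p] p by blast
qed

lemma orthogonal_to_dense_eq_0:
  fixes y :: "'h::real_inner"
  assumes "closure S = UNIV" and "\<And>v. v \<in> S \<Longrightarrow> v \<bullet> y = 0"
  shows "y = 0"
proof -
  have "S \<subseteq> {v. y \<bullet> v = 0}" using assms(2) by (auto simp: inner_commute)
  moreover have "closed {v. y \<bullet> v = 0}"
    by (intro closed_Collect_eq continuous_intros)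
  ultimately have "UNIV \<subseteq> {v. y \<bullet> v = 0}" unfolding assms(1)[symmetric] by (rule closure_minimal)
  then show ?thesis using inner_eq_zero_iff by blast
qed

text \<open>
  The seminorm is an infimum of admissible constants. A bound by \<open>1\<close> supplies an admissible constant
  below each \<open>c > 1\<close>, and the estimate for \<open>c\<close> passes to the limit \<open>c \<rightarrow> 1\<close>.
\<close>

lemma lip_seminorm_le_1_iff:
  assumes "\<And>x y. x \<in> X \<Longrightarrow> y \<in> X \<Longrightarrow> nX (x - y) \<ge> 0"
  shows "lip_seminorm nX nY X f \<le> 1 \<longleftrightarrow> (\<forall>x\<in>X. \<forall>y\<in>X. nY (f x - f y) \<le> nX (x - y))"
proof
  assume le1: "lip_seminorm nX nY X f \<le> 1"
  show "\<forall>x\<in>X. \<forall>y\<in>X. nY (f x - f y) \<le> nX (x - y)"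
  proof (intro ballI)
    fix x y assume xy: "x \<in> X" "y \<in> X"
    have "nY (f x - f y) \<le> c * nX (x - y)" if "1 < c" for c
    proof -
      have "lip_seminorm nX nY X f < ereal c"
        using le_less_trans[OF le1] that by simp
      then obtain L where L: "L < c" "nY (f x - f y) \<le> L * nX (x - y)"
        using xy by (auto simp: lip_seminorm_def Inf_less_iff)
      show ?thesis using L assms[OF xy] mult_right_mono[of L c "nX (x - y)"] by linarith
    qed
    then have "eventually (\<lambda>c. nY (f x - f y) \<le> c * nX (x - y)) (at_right 1)"
      using eventually_at_right_less by (rule eventually_mono[rotated])
    moreover have "((\<lambda>c. c * nX (x - y)) \<longlongrightarrow> 1 * nX (x - y)) (at_right 1)"
      by (intro tendsto_intros)
    ultimately show "nY (f x - f y) \<le> nX (x - y)"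
      using tendsto_lowerbound[OF _ _ trivial_limit_at_right_real] by fastforce
  qed
next
  assume "\<forall>x\<in>X. \<forall>y\<in>X. nY (f x - f y) \<le> nX (x - y)"
  then show "lip_seminorm nX nY X f \<le> 1"
    unfolding lip_seminorm_def one_ereal_def by (intro Inf_lower) auto
qed

section \<open>Linear operators and graph inner products\<close>

lemma app_eqI: "linear_op T \<Longrightarrow> (x, y) \<in> T \<Longrightarrow> app T x = y"
  unfolding app_def linear_op_def by (blast intro: the_equality dest: single_valuedD)

lemma app_mem: "linear_op T \<Longrightarrow> x \<in> Domain T \<Longrightarrow> (x, app T x) \<in> T"
  using app_eqI by fastforce

lemma linear_op_diff_mem:
  "linear_op T \<Longrightarrow> (x, y) \<in> T \<Longrightarrow> (x', y') \<in> T \<Longrightarrow> (x - x', y - y') \<in> T"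
  unfolding linear_op_def using subspace_diff by fastforce

lemma linear_op_add_mem:
  "linear_op T \<Longrightarrow> (x, y) \<in> T \<Longrightarrow> (x', y') \<in> T \<Longrightarrow> (x + x', y + y') \<in> T"
  unfolding linear_op_def using subspace_add by fastforce

lemma linear_op_scale_mem: "linear_op T \<Longrightarrow> (x, y) \<in> T \<Longrightarrow> (c *\<^sub>R x, c *\<^sub>R y) \<in> T"
  unfolding linear_op_def using subspace_scale by fastforce

lemma linear_op_zero_mem: "linear_op T \<Longrightarrow> (0, 0) \<in> T"
  unfolding linear_op_def using subspace_0 by (fastforce simp: zero_prod_def)

lemma subspace_Domain: "linear_op T \<Longrightarrow> subspace (Domain T)"
  unfolding subspace_def
  by (blast intro: linear_op_zero_mem linear_op_add_mem linear_op_scale_mem)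

lemma app_add: "linear_op T \<Longrightarrow> x \<in> Domain T \<Longrightarrow> y \<in> Domain T \<Longrightarrow> app T (x + y) = app T x + app T y"
  by (blast intro: app_eqI linear_op_add_mem app_mem)

lemma app_diff: "linear_op T \<Longrightarrow> x \<in> Domain T \<Longrightarrow> y \<in> Domain T \<Longrightarrow> app T (x - y) = app T x - app T y"
  by (blast intro: app_eqI linear_op_diff_mem app_mem)

lemma app_scale: "linear_op T \<Longrightarrow> x \<in> Domain T \<Longrightarrow> app T (c *\<^sub>R x) = c *\<^sub>R app T x"
  by (blast intro: app_eqI linear_op_scale_mem app_mem)

lemma graph_inner_eq_inner: "graph_inner T x y = (x, app T x) \<bullet> (y, app T y)"
  by (simp add: graph_inner_def)

lemma graph_inner_commute: "graph_inner T x y = graph_inner T y x"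
  by (simp add: graph_inner_def inner_commute)

lemma graph_norm_eq_norm: "graph_norm T x = norm (x, app T x)"
  by (simp add: graph_norm_def graph_inner_eq_inner norm_eq_sqrt_inner)

lemma graph_norm_nonneg: "0 \<le> graph_norm T x"
  by (simp add: graph_norm_eq_norm)

text \<open>
  Only uniqueness needs an argument: the difference of two candidates lies in \<open>S\<close> and is
  graph-orthogonal to itself, and the graph inner product is definite.
\<close>

lemma orth_proj_eqI:
  assumes T: "linear_op T" and S: "subspace S" "S \<subseteq> Domain T"
    and x: "x \<in> Domain T" and p: "p \<in> S"
    and orth: "\<And>s. s \<in> S \<Longrightarrow> graph_inner T (x - p) s = 0"
  shows "orth_proj (graph_inner T) S x = p"
  unfolding orth_proj_def
proof (rule the_equality)
  show "p \<in> S \<and> (\<forall>s\<in>S. graph_inner T (x - p) s = 0)" using p orth by blast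
next
  fix q assume q: "q \<in> S \<and> (\<forall>s\<in>S. graph_inner T (x - q) s = 0)"
  have dom: "p \<in> Domain T" "q \<in> Domain T" using S p q by auto
  have s: "p - q \<in> S" using S p q by (simp add: subspace_diff)
  have "graph_inner T (p - q) (p - q)
      = graph_inner T (x - q) (p - q) - graph_inner T (x - p) (p - q)"
    using T x dom unfolding graph_inner_def
    by (simp add: app_diff inner_diff_left)
  also have "\<dots> = 0" using orth s q by simp
  finally have "(p - q) \<bullet> (p - q) + app T (p - q) \<bullet> app T (p - q) = 0"
    by (simp add: graph_inner_def)
  then have "(p - q) \<bullet> (p - q) = 0"
    using inner_ge_zero[of "p - q"] inner_ge_zero[of "app T (p - q)"] by linarith
  then show "q = p" by simp
qed

section \<open>Minty's correspondence on a space with a graph norm\<close>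

text \<open>
  The squares of the two norms differ by four times the inner product. This turns accretivity into
  nonexpansiveness.
\<close>

lemma graph_polarization:
  assumes T: "linear_op T" and "a \<in> Domain T" "b \<in> Domain T"
  shows "graph_norm T (a - b) \<le> graph_norm T (a + b) \<longleftrightarrow> 0 \<le> graph_inner T a b"
  unfolding graph_norm_def graph_inner_def using assms
  by (simp add: app_diff app_add inner_diff_left inner_diff_right inner_add_left
      inner_add_right inner_commute) linarith

text \<open>
  The Cayley relation is the graph of \<open>f\<close> in the coordinates \<open>(a + b) / 2\<close> and \<open>(a - b) / 2\<close>.
\<close>

lemma mem_cayley_rel_iff:
  assumes "subspace X" "f \<in> X \<rightarrow> X"
  shows "(a, b) \<in> cayley_rel X f \<longleftrightarrow>
    a \<in> X \<and> b \<in> X \<and> f ((1/2) *\<^sub>R (a + b)) = (1/2) *\<^sub>R (a - b)"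
proof (intro iffI conjI)
  assume "(a, b) \<in> cayley_rel X f"
  then obtain w where w: "w \<in> X" "a = w + f w" "b = w - f w"
    by (auto simp: cayley_rel_def)
  have fw: "f w \<in> X" using w assms by auto
  show "a \<in> X" "b \<in> X" using w fw assms by (simp_all add: subspace_add subspace_diff)
  have "(1/2) *\<^sub>R (a + b) = w" "(1/2) *\<^sub>R (a - b) = f w"
    unfolding w by (simp_all add: algebra_simps flip: scaleR_2 scaleR_add_left)
  then show "f ((1/2) *\<^sub>R (a + b)) = (1/2) *\<^sub>R (a - b)" by simp
next
  assume h: "a \<in> X \<and> b \<in> X \<and> f ((1/2) *\<^sub>R (a + b)) = (1/2) *\<^sub>R (a - b)"
  have "(1/2) *\<^sub>R (a + b) \<in> X" using h assms by (simp add: subspace_add subspace_scale)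
  moreover have "a = (1/2) *\<^sub>R (a + b) + (1/2) *\<^sub>R (a - b)"
    "b = (1/2) *\<^sub>R (a + b) - (1/2) *\<^sub>R (a - b)"
    by (simp_all add: algebra_simps flip: scaleR_2 scaleR_add_left)
  ultimately show "(a, b) \<in> cayley_rel X f" 
    using h unfolding cayley_rel_def mem_Collect_eq by (intro exI[of _ "(1/2) *\<^sub>R (a + b)"]) auto
qed

lemma cayley_rel_inj:
  assumes X: "subspace X" and f: "f \<in> X \<rightarrow> X" and g: "g \<in> X \<rightarrow> X"
    and eq: "cayley_rel X f = cayley_rel X g" and w: "w \<in> X"
  shows "f w = g w"
proof -
  have "(w + f w, w - f w) \<in> cayley_rel X f" using w by (auto simp: cayley_rel_def)
  then have "(w + f w, w - f w) \<in> cayley_rel X g" by (simp only: eq)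
  then have "g ((1/2) *\<^sub>R ((w + f w) + (w - f w))) = (1/2) *\<^sub>R ((w + f w) - (w - f w))"
    by (simp only: mem_cayley_rel_iff[OF X g])
  then show ?thesis by (simp add: algebra_simps flip: scaleR_2 scaleR_add_left)
qed

text \<open>
  The relation of \<open>f\<close> takes every value \<open>g\<close> as \<open>u + v\<close>, namely at the parameter \<open>g / 2\<close>, so the range
  condition is free and only accretivity matters; that is \<open>graph_polarization\<close> applied to
  differences of two pairs.
\<close>

lemma m_accretive_cayley_rel_iff:
  assumes T: "linear_op T" and X: "subspace X" "X \<subseteq> Domain T" and f: "f \<in> X \<rightarrow> X"
  shows "m_accretive_on X (graph_inner T) (cayley_rel X f)
    \<longleftrightarrow> lip_seminorm (graph_norm T) (graph_norm T) X f \<le> 1"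
proof -
  have mono: "0 \<le> graph_inner T ((x - f x) - (w - f w)) ((x + f x) - (w + f w))
      \<longleftrightarrow> graph_norm T (f x - f w) \<le> graph_norm T (x - w)" if "x \<in> X" "w \<in> X" for x w
  proof -
    define a b where "a = (x - f x) - (w - f w)" and "b = (x + f x) - (w + f w)"
    have fX: "f x \<in> X" "f w \<in> X" using f that by auto
    have "a \<in> X" "b \<in> X" "f x - f w \<in> X" "x - w \<in> X"
      unfolding a_def b_def using that fX X(1) by (simp_all add: subspace_add subspace_diff)
    then have "a \<in> Domain T" "b \<in> Domain T"
      and D: "f x - f w \<in> Domain T" "x - w \<in> Domain T"
      using X(2) by blast+
    have ab: "a - b = (-2) *\<^sub>R (f x - f w)" "a + b = 2 *\<^sub>R (x - w)"
      unfolding a_def b_def by (simp_all add: algebra_simps scaleR_2)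
    have scale: "graph_norm T (c *\<^sub>R z) = \<bar>c\<bar> * graph_norm T z" if "z \<in> Domain T" for c z
      using T that by (simp add: graph_norm_eq_norm app_scale flip: norm_scaleR)
    show ?thesis
      unfolding a_def[symmetric] b_def[symmetric]
        graph_polarization[OF T \<open>a \<in> Domain T\<close> \<open>b \<in> Domain T\<close>, symmetric] ab
      using D by (simp only: scale) simp
  qed
  have "cayley_rel X f \<subseteq> X \<times> X"
    using mem_cayley_rel_iff[OF X(1) f] by auto
  moreover have "(\<forall>p\<in>cayley_rel X f. Q p) \<longleftrightarrow> (\<forall>w\<in>X. Q (w + f w, w - f w))" for Q
    by (auto simp: cayley_rel_def)
  ultimately have acc: "accretive_on X (graph_inner T) (cayley_rel X f) \<longleftrightarrow>
      (\<forall>x\<in>X. \<forall>w\<in>X. graph_norm T (f x - f w) \<le> graph_norm T (x - w))"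
    by (simp add: accretive_on_def mono) blast
  have "\<exists>(u, v) \<in> cayley_rel X f. u + v = g" if "g \<in> X" for g
    by (rule bexI[of _ "((1/2) *\<^sub>R g + f ((1/2) *\<^sub>R g), (1/2) *\<^sub>R g - f ((1/2) *\<^sub>R g))"])
      (use that X in \<open>auto simp: cayley_rel_def subspace_scale simp flip: scaleR_add_left\<close>)
  then show ?thesis
    unfolding m_accretive_on_def acc
    by (auto simp: lip_seminorm_le_1_iff graph_norm_nonneg)
qed

text \<open>
  Accretivity makes \<open>u + v\<close> determine the pair \<open>(u, v)\<close> of \<open>M\<close>, and the range condition makes \<open>u + v\<close>
  arbitrary. The pair with \<open>u + v = 2 w\<close> is therefore a function of \<open>w\<close>, and \<open>f w\<close> is half its
  difference.
\<close>

lemma m_accretive_imp_cayley_rel: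
  assumes T: "linear_op T" and X: "subspace X" "X \<subseteq> Domain T"
    and M: "m_accretive_on X (graph_inner T) M"
  shows "\<exists>f\<in>X \<rightarrow> X. M = cayley_rel X f"
proof -
  have MX: "M \<subseteq> X \<times> X" using M by (auto simp: m_accretive_on_def accretive_on_def)
  \<comment> \<open>differences with equal sums are antiparallel, so accretivity bounds their length by \<open>0\<close>\<close>
  have uniq: "u = u' \<and> v = v'" if "(u, v) \<in> M" "(u', v') \<in> M" "u + v = u' + v'" for u v u' v'
  proof -
    have "u - u' \<in> X" "v - v' \<in> X"
      using MX X(1) that by (auto intro: subspace_diff[OF X(1)])
    then have D: "u - u' \<in> Domain T" "v - v' \<in> Domain T" using X(2) by blast+
    have vv: "v - v' = - (u - u')" using that(3) by (simp add: algebra_simps)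
    have "0 \<le> graph_inner T (v - v') (u - u')"
      using M that unfolding m_accretive_on_def accretive_on_def by blast
    then have "graph_norm T ((v - v') - (u - u')) \<le> graph_norm T ((v - v') + (u - u'))"
      using graph_polarization[OF T D(2,1)] by blast
    also have "\<dots> = graph_norm T 0" by (simp add: vv)
    also have "\<dots> = 0"
      using app_eqI[OF T linear_op_zero_mem[OF T]] by (simp add: graph_norm_eq_norm)
    finally have "norm ((v - v') - (u - u')) \<le> 0"
      unfolding graph_norm_eq_norm using norm_fst_le order_trans by blast
    then have "(v - v') - (u - u') = 0" by simp
    then have "- (u - u') - (u - u') = 0" by (simp only: vv)
    then have "2 *\<^sub>R (u - u') = 0" by (simp add: scaleR_2 algebra_simps)
    then show ?thesis using that(3) by simp
  qed
  have "\<exists>p. p \<in> M \<and> fst p + snd p = 2 *\<^sub>R w" if "w \<in> X" for w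
  proof -
    have "2 *\<^sub>R w \<in> X" using X that by (simp add: subspace_scale)
    then obtain p where "p \<in> M" "case p of (u, v) \<Rightarrow> u + v = 2 *\<^sub>R w"
      using M unfolding m_accretive_on_def by blast
    then show ?thesis by (intro exI[of _ p]) (auto simp: case_prod_unfold)
  qed
  then obtain P where P: "\<And>w. w \<in> X \<Longrightarrow> P w \<in> M" "\<And>w. w \<in> X \<Longrightarrow> fst (P w) + snd (P w) = 2 *\<^sub>R w"
    by metis
  define f where "f w = w - snd (P w)" for w
  have f: "f \<in> X \<rightarrow> X"
    using P(1) MX by (fastforce simp: f_def mem_Times_iff intro: subspace_diff[OF X(1)])
  have Pf: "P w = (w + f w, w - f w)" if "w \<in> X" for w
    using P(2)[OF that] by (simp add: f_def prod_eq_iff scaleR_2 algebra_simps)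
  have "M = cayley_rel X f"
  proof (intro equalityI subsetI)
    fix z assume z: "z \<in> M"
    obtain u v where uv: "z = (u, v)" by fastforce
    define w where "w = (1/2) *\<^sub>R (u + v)"
    have w: "w \<in> X" unfolding w_def using z uv MX
      by (auto intro: subspace_add[OF X(1)] subspace_scale[OF X(1)])
    have "u + v = 2 *\<^sub>R w" by (simp add: w_def)
    then have "z = P w"
      using uniq[of u v "fst (P w)" "snd (P w)"] P[OF w] z uv by (simp add: prod_eq_iff)
    then show "z \<in> cayley_rel X f" using Pf[OF w] w by (auto simp: cayley_rel_def)
  next
    fix z assume "z \<in> cayley_rel X f"
    then show "z \<in> M" using Pf P(1) unfolding cayley_rel_def by force
  qed
  then show ?thesis using f by blast
qed

section \<open>Boundary data spaces\<close>

text \<open>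
  The hypotheses are invariant under exchanging the pairs \<open>(G0, G)\<close> and \<open>(D0, D)\<close>. The sublocale
  makes each fact available in the exchanged form, with the prefix \<open>swap\<close>, once the context in which
  it was proved has been closed; this is why the context is reopened several times.
\<close>

locale boundary_pair =
  fixes G0 G :: "('a::{real_inner,complete_space} \<times> 'b::{real_inner,complete_space}) set"
    and D0 D :: "('b \<times> 'a) set"
  assumes linear_G0: "linear_op G0" and closed_G0: "closed G0" and dense_G0: "densely_defined G0"
    and linear_D0: "linear_op D0" and closed_D0: "closed D0" and dense_D0: "densely_defined D0"
    and G_def: "G = neg_op (adjoint_op D0)" and G0_sub: "G0 \<subseteq> G"
    and D_def: "D = neg_op (adjoint_op G0)" and D0_sub: "D0 \<subseteq> D"
begin

sublocale swap: boundary_pair D0 D G0 G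
  by unfold_locales
    (fact linear_G0 closed_G0 dense_G0 linear_D0 closed_D0 dense_D0 G_def G0_sub D_def D0_sub)+

lemma mem_G_iff: "(u, y) \<in> G \<longleftrightarrow> (\<forall>(v, x) \<in> D0. x \<bullet> u + v \<bullet> y = 0)"
proof -
  have "(u, y) \<in> G \<longleftrightarrow> (u, - y) \<in> adjoint_op D0"
    unfolding G_def neg_op_def by force
  then show ?thesis by (auto simp: adjoint_op_def eq_neg_iff_add_eq_0)
qed

text \<open>
  As in the general theory of adjoints, the graph is cut out by linear equations, and it is
  single-valued because the domain of \<open>D0\<close> is dense.
\<close>

lemma linear_G: "linear_op G"
  unfolding linear_op_def
proof
  show "single_valued G"
  proof (rule single_valuedI)
    fix u y y' assume "(u, y) \<in> G" "(u, y') \<in> G"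
    then have "v \<bullet> (y - y') = 0" if "v \<in> Domain D0" for v
      using that unfolding mem_G_iff by (force simp: inner_diff_right)
    then have "y - y' = 0"
      using dense_D0 orthogonal_to_dense_eq_0 unfolding densely_defined_def by blast
    then show "y = y'" by simp
  qed
  show "subspace G"
    unfolding subspace_def
  proof (intro conjI ballI allI)
    show "0 \<in> G" by (simp add: zero_prod_def mem_G_iff)
    show "p + q \<in> G" if "p \<in> G" "q \<in> G" for p q
      using that by (cases p; cases q) (fastforce simp: mem_G_iff inner_add_right)
    show "c *\<^sub>R p \<in> G" if "p \<in> G" for c p
      using that by (cases p) (fastforce simp: mem_G_iff simp flip: distrib_left)
  qed
qed

end

context boundary_pair
begin

lemmas linear_D = swap.linear_G

lemma orthogonal_G0_imp_mem_D:
  assumes "\<And>z. z \<in> G0 \<Longrightarrow> (a, b) \<bullet> z = 0"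
  shows "(b, a) \<in> D"
  unfolding swap.mem_G_iff
proof (clarify)
  fix u y assume "(u, y) \<in> G0"
  from assms[OF this] show "y \<bullet> b + u \<bullet> a = 0" by (simp add: inner_commute add.commute)
qed

text \<open>
  The orthogonal complement of the closed subspace \<open>G0\<close> is the flipped graph of \<open>D\<close>, so every pair
  \<open>(a, b)\<close> splits into a member of \<open>G0\<close> and a flipped member of \<open>D\<close>. Both the boundary decomposition
  of the domain of \<open>G\<close> and the surjectivity of \<open>1 + A\<close> are instances.
\<close>

lemma G0_complement: "\<exists>(u, y)\<in>G0. (b - y, a - u) \<in> D"
proof -
  obtain p where p: "p \<in> G0" "\<forall>s\<in>G0. ((a, b) - p) \<bullet> s = 0"
    using orthogonal_decomposition[of G0 "(a, b)"] linear_G0 closed_G0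
    unfolding linear_op_def by blast
  then have "(b - snd p, a - fst p) \<in> D"
    by (intro orthogonal_G0_imp_mem_D) (metis minus_prod_def fst_conv snd_conv)
  then show ?thesis
    using p(1) by (intro bexI[of _ p]) (simp_all add: case_prod_unfold)
qed

lemma green_G0:
  assumes "(u, y) \<in> G0" "(v, x) \<in> D"
  shows "y \<bullet> v + u \<bullet> x = 0"
  using assms swap.mem_G_iff by blast

text \<open>
  A description of the boundary data space that avoids the value of the composed operator.
\<close>

lemma BD_iff: "p \<in> BD G D \<longleftrightarrow> p \<in> Domain G \<and> (app G p, p) \<in> D"
proof -
  have GD: "(p, x) \<in> G O D \<longleftrightarrow> p \<in> Domain G \<and> (app G p, x) \<in> D" for x
    using app_mem[OF linear_G] app_eqI[OF linear_G] by blast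
  have app: "app (G O D) p = x" if "(p, x) \<in> G O D" for x
    unfolding app_def using that single_valued_relcomp[of G D] linear_G linear_D
    by (auto simp: linear_op_def intro!: the_equality dest: single_valuedD)
  show ?thesis
    unfolding BD_def using app GD by (auto simp: Domain_iff) (metis)
qed

lemma BD_I:
  assumes "(p, q) \<in> G" "(q, p) \<in> D"
  shows "p \<in> BD G D" "app G p = q"
  using assms app_eqI[OF linear_G] by (auto simp: BD_iff)

lemma BD_graph:
  assumes "p \<in> BD G D"
  shows "(p, app G p) \<in> G" "(app G p, p) \<in> D" 
  using assms app_mem[OF linear_G] by (auto simp: BD_iff)

lemma BD_sub_Domain: "BD G D \<subseteq> Domain G"
  by (auto simp: BD_iff)

end

context boundary_pair
begin

lemma BD_swap:
  assumes "p \<in> BD G D"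
  shows "app G p \<in> BD D G" "app D (app G p) = p"
  using swap.BD_I[OF BD_graph(2,1)[OF assms]] by blast+

lemma subspace_BD: "subspace (BD G D)"
  unfolding subspace_def
  using BD_I(1) BD_graph linear_op_zero_mem linear_op_add_mem linear_op_scale_mem
    linear_G linear_D by metis

end

context boundary_pair
begin

text \<open>
  Applied to the pair \<open>(u, G u)\<close>, the splitting along \<open>G0\<close> leaves a remainder whose graph
  pair lies in \<open>G\<close> and, flipped, in \<open>D\<close>; so the remainder is boundary data, and it is the
  orthogonal projection.
\<close>

lemma proj_BD:
  assumes u: "u \<in> Domain G"
  shows "proj_BD G D u \<in> BD G D"
    and "(u - proj_BD G D u, app G u - app G (proj_BD G D u)) \<in> G0"
proof -
  obtain g y where gy: "(g, y) \<in> G0" and d: "(app G u - y, u - g) \<in> D"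
    using G0_complement[of "app G u" u] by blast
  define p where "p = u - g"
  have "(p, app G u - y) \<in> G"
    unfolding p_def using gy G0_sub u by (blast intro: linear_op_diff_mem linear_G app_mem)
  note p = BD_I[OF this, unfolded p_def, OF d, folded p_def]
  have "graph_inner G (u - p) s = 0" if "s \<in> BD G D" for s
    using green_G0[OF gy BD_graph(2)[OF that]] app_eqI[OF linear_G subsetD[OF G0_sub gy]]
    by (simp add: p_def graph_inner_def)
  then have "proj_BD G D u = p"
    using orth_proj_eqI linear_G subspace_BD BD_sub_Domain u p(1) by blast
  then show "proj_BD G D u \<in> BD G D"
    "(u - proj_BD G D u, app G u - app G (proj_BD G D u)) \<in> G0"
    using p gy by (simp_all add: p_def)
qed

lemma graph_inner_proj_BD:
  assumes u: "u \<in> Domain G" and s: "s \<in> BD G D"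
  shows "graph_inner G u s = graph_inner G (proj_BD G D u) s"
  using green_G0[OF proj_BD(2)[OF u] BD_graph(2)[OF s]]
  by (simp add: graph_inner_def inner_diff_left)

lemma proj_BD_eqI:
  assumes u: "u \<in> Domain G" and p: "p \<in> BD G D"
    and "\<And>s. s \<in> BD G D \<Longrightarrow> graph_inner G u s = graph_inner G p s"
  shows "proj_BD G D u = p"
proof (rule orth_proj_eqI[OF linear_G subspace_BD BD_sub_Domain u p])
  fix s assume "s \<in> BD G D"
  from assms(3)[OF this] show "graph_inner G (u - p) s = 0"
    using app_diff[OF linear_G u subsetD[OF BD_sub_Domain p]]
    by (simp add: graph_inner_def inner_diff_left)
qed

lemma proj_BD_ident: "p \<in> BD G D \<Longrightarrow> proj_BD G D p = p"
  using BD_sub_Domain by (blast intro: proj_BD_eqI)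

lemma proj_BD_diff:
  assumes "u \<in> Domain G" "w \<in> Domain G"
  shows "proj_BD G D (u - w) = proj_BD G D u - proj_BD G D w"
proof (rule proj_BD_eqI)
  show "u - w \<in> Domain G" using assms subspace_diff subspace_Domain linear_G by blast
  show "proj_BD G D u - proj_BD G D w \<in> BD G D"
    using assms proj_BD(1) subspace_diff subspace_BD by blast
  fix s assume s: "s \<in> BD G D"
  have "proj_BD G D u \<in> Domain G" "proj_BD G D w \<in> Domain G"
    using proj_BD(1) assms BD_sub_Domain by blast+
  then show "graph_inner G (u - w) s = graph_inner G (proj_BD G D u - proj_BD G D w) s"
    using graph_inner_proj_BD[OF assms(1) s] graph_inner_proj_BD[OF assms(2) s] assms
    by (simp add: graph_inner_def app_diff[OF linear_G] inner_diff_left)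
qed

end

section \<open>The boundary trace and Green's formula\<close>

context boundary_pair
begin

definition boundary_trace :: "'a \<times> 'b \<Rightarrow> 'a \<times> 'a" where
  "boundary_trace x = (proj_BD G D (fst x), app D (proj_BD D G (snd x)))"

abbreviation "A \<equiv> block_op D G"

lemma Domain_A: "Domain A = Domain G \<times> Domain D"
  by (fastforce simp: block_op_def)

lemma Domain_A_D: "x \<in> Domain A \<Longrightarrow> fst x \<in> Domain G" "x \<in> Domain A \<Longrightarrow> snd x \<in> Domain D"
  unfolding Domain_A by (simp_all add: mem_Times_iff)

lemma linear_A: "linear_op A"
  unfolding linear_op_def
proof
  show "single_valued A"
    using linear_G linear_D by (auto simp: linear_op_def single_valued_def block_op_def)
  show "subspace A"
    unfolding subspace_def block_op_def zero_prod_def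
    by (auto intro: linear_op_zero_mem linear_op_add_mem linear_op_scale_mem linear_G linear_D)
qed

lemma app_A:
  assumes "x \<in> Domain A"
  shows "app A x = (app D (snd x), app G (fst x))"
  using app_mem[OF linear_G Domain_A_D(1)[OF assms]] app_mem[OF linear_D Domain_A_D(2)[OF assms]]
  by (intro app_eqI[OF linear_A]) (simp add: block_op_def case_prod_unfold)

lemma boundary_trace_mem:
  "x \<in> Domain A \<Longrightarrow> boundary_trace x \<in> BD G D \<times> BD G D"
  unfolding boundary_trace_def
  by (simp add: proj_BD(1) swap.proj_BD(1) swap.BD_swap(1) Domain_A_D)

lemma boundary_trace_diff:
  assumes "x \<in> Domain A" "y \<in> Domain A"
  shows "boundary_trace (x - y) = boundary_trace x - boundary_trace y"
proof -
  have "proj_BD D G (snd x) \<in> Domain D" "proj_BD D G (snd y) \<in> Domain D"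
    using assms[THEN Domain_A_D(2)] swap.proj_BD(1) swap.BD_sub_Domain by blast+
  then show ?thesis
    unfolding boundary_trace_def
    by (simp add: assms Domain_A_D proj_BD_diff swap.proj_BD_diff app_diff[OF linear_D])
qed

lemma boundary_trace_lift:
  assumes "a \<in> BD G D" "b \<in> BD G D"
  shows "(a, app G b) \<in> Domain A" "boundary_trace (a, app G b) = (a, b)"
proof -
  show "(a, app G b) \<in> Domain A"
    using assms BD_sub_Domain BD_graph(2) by (auto simp: Domain_A)
  show "boundary_trace (a, app G b) = (a, b)"
    using assms by (simp add: boundary_trace_def proj_BD_ident swap.proj_BD_ident BD_swap)
qed

text \<open>
  Split off the boundary part of \<open>u\<close>, then that of \<open>v\<close>: each time the other part lies in the
  domain of \<open>G0\<close> or \<open>D0\<close> and contributes nothing. What remains pairs boundary data only, and \<open>G D\<close> is the identity there.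
\<close>

lemma green:
  assumes "x \<in> Domain A"
  shows "app A x \<bullet> x = graph_inner G (fst (boundary_trace x)) (snd (boundary_trace x))"
proof -
  obtain u v where x: "x = (u, v)" "u \<in> Domain G" "v \<in> Domain D"
    using assms by (auto simp: Domain_A)
  define p q where "p = proj_BD G D u" and "q = proj_BD D G v"
  have p: "p \<in> BD G D" and q: "q \<in> BD D G"
    using proj_BD(1) swap.proj_BD(1) x by (auto simp: p_def q_def)
  have "(app G u - app G p) \<bullet> v + (u - p) \<bullet> app D v = 0"
    using green_G0[OF proj_BD(2)[OF x(2)] app_mem[OF linear_D x(3)]] by (simp add: p_def)
  moreover have "(app D v - app D q) \<bullet> p + (v - q) \<bullet> app G p = 0"
    using swap.green_G0[OF swap.proj_BD(2)[OF x(3)] BD_graph(1)[OF p]] by (simp add: q_def)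
  ultimately have "app G u \<bullet> v + u \<bullet> app D v = app G p \<bullet> q + p \<bullet> app D q"
    by (simp add: inner_diff_left inner_diff_right inner_commute)
  moreover have "app G (app D q) = q" using swap.BD_swap(2)[OF q] .
  ultimately show ?thesis
    using app_A[OF assms]
    by (simp add: x boundary_trace_def graph_inner_def inner_commute flip: p_def q_def)
qed

text \<open>
  Writing \<open>g\<close> as a sum of some \<open>(u, G0 u)\<close> and a flipped member \<open>(D v, v)\<close> of \<open>D\<close> solves the system
  \<open>u + D v = g\<^sub>0\<close>, \<open>v + G u = g\<^sub>1\<close>.
\<close>

lemma one_plus_A_surj: "\<exists>x\<in>Domain A. x + app A x = g"
proof -
  obtain u y where uy: "(u, y) \<in> G0" "(snd g - y, fst g - u) \<in> D"
    using G0_complement[of "snd g" "fst g"] by blast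
  then have "((u, snd g - y), (fst g - u, y)) \<in> A"
    using G0_sub by (auto simp: block_op_def)
  from app_eqI[OF linear_A this] DomainI[OF this] show ?thesis
    by (intro bexI[of _ "(u, snd g - y)"]) (auto simp: prod_eq_iff)
qed

lemma ker_one_minus_A: "ker_one_minus A = (\<lambda>w. (w, app G w)) ` BD G D"
proof (intro equalityI subsetI)
  fix x assume "x \<in> ker_one_minus A"
  then have x: "x \<in> Domain A" "x = app A x" by (auto simp: ker_one_minus_def)
  then have "(x, x) \<in> A" using app_mem[OF linear_A] by metis
  then have "(fst x, snd x) \<in> G" "(snd x, fst x) \<in> D" by (auto simp: block_op_def)
  from BD_I[OF this] show "x \<in> (\<lambda>w. (w, app G w)) ` BD G D"
    by (intro image_eqI[of _ _ "fst x"]) simp_all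
next
  fix x assume "x \<in> (\<lambda>w. (w, app G w)) ` BD G D"
  then have "(x, x) \<in> A" using BD_graph by (auto simp: block_op_def)
  then show "x \<in> ker_one_minus A" using app_eqI[OF linear_A] by (auto simp: ker_one_minus_def)
qed

lemma ker_one_plus_A: "ker_one_plus A = (\<lambda>w. (w, - app G w)) ` BD G D"
proof (intro equalityI subsetI)
  fix x assume "x \<in> ker_one_plus A"
  then have x: "x \<in> Domain A" "- x = app A x"
    by (simp_all add: ker_one_plus_def minus_unique)
  then have "(x, - x) \<in> A" using app_mem[OF linear_A] by metis
  then have "(fst x, - snd x) \<in> G" "(snd x, - fst x) \<in> D" by (auto simp: block_op_def)
  moreover from this(2) have "(- snd x, fst x) \<in> D"
    using linear_op_scale_mem[OF linear_D, of _ _ "-1"] by fastforce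
  ultimately show "x \<in> (\<lambda>w. (w, - app G w)) ` BD G D"
    using BD_I[of "fst x" "- snd x"] by (intro image_eqI[of _ _ "fst x"]) simp_all
next
  fix x assume "x \<in> (\<lambda>w. (w, - app G w)) ` BD G D"
  then obtain w where w: "x = (w, - app G w)" "w \<in> BD G D" by blast
  have "(- app G w, - w) \<in> D"
    using linear_op_scale_mem[OF linear_D BD_graph(2)[OF w(2)], of "-1"] by simp
  then have "(x, - x) \<in> A" using w BD_graph by (auto simp: block_op_def)
  then show "x \<in> ker_one_plus A" using app_eqI[OF linear_A] by (auto simp: ker_one_plus_def)
qed

lemma green_diff:
  assumes "x \<in> Domain A" "y \<in> Domain A"
  shows "(app A x - app A y) \<bullet> (x - y) =
    graph_inner G (fst (boundary_trace x) - fst (boundary_trace y))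
      (snd (boundary_trace x) - snd (boundary_trace y))"
proof -
  have "x - y \<in> Domain A" using assms subspace_diff[OF subspace_Domain[OF linear_A]] by blast
  from green[OF this] show ?thesis
    using assms by (simp add: boundary_trace_diff app_diff[OF linear_A])
qed

lemma m_accretive_restriction_iff:
  assumes C: "C \<subseteq> A"
  shows "m_accretive_on UNIV inner C \<longleftrightarrow>
    (\<forall>x\<in>Domain C. \<forall>y\<in>Domain C. 0 \<le> (app A x - app A y) \<bullet> (x - y))
    \<and> (\<forall>g. \<exists>x\<in>Domain C. x + app A x = g)"
proof -
  have graph: "(x, y) \<in> C \<longleftrightarrow> x \<in> Domain C \<and> y = app A x" for x y
    using C app_eqI[OF linear_A] by blast
  have ball: "(\<forall>z\<in>C. Q z) \<longleftrightarrow> (\<forall>x\<in>Domain C. Q (x, app A x))" for Q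
    using graph by auto
  have bex: "(\<exists>z\<in>C. Q z) \<longleftrightarrow> (\<exists>x\<in>Domain C. Q (x, app A x))" for Q
    using graph by (metis surj_pair)
  show ?thesis unfolding m_accretive_on_def accretive_on_def ball bex by auto
qed

text \<open>
  For \<open>c = 1\<close> and \<open>c = -1\<close> these are the eigenvectors of \<open>A\<close>; the case \<open>c = 0\<close> realizes
  the trace \<open>(w, 0)\<close>, whose sum is \<open>w\<close>.
\<close>

lemma boundary_trace_eigenvector:
  assumes w: "w \<in> BD G D"
  shows "(w, c *\<^sub>R app G w) \<in> Domain A"
    and "boundary_trace (w, c *\<^sub>R app G w) = (w, c *\<^sub>R w)"
  using boundary_trace_lift[OF w subspace_scale[OF subspace_BD w, of c]]
    app_scale[OF linear_G subsetD[OF BD_sub_Domain w], of c]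
  by simp_all

lemma app_A_antieigenvector:
  assumes w: "w \<in> BD G D"
  shows "app A (w, - app G w) = - (w, - app G w)"
proof -
  have "(w, - app G w) \<in> ker_one_plus A" unfolding ker_one_plus_A using w by blast
  then show ?thesis by (simp add: ker_one_plus_def minus_unique[symmetric] del: uminus_Pair)
qed

section \<open>m-accretive restrictions and m-accretive boundary relations\<close>

lemma describes_BD_rel_iff:
  "describes_BD_rel G D C M \<longleftrightarrow>
    m_accretive_on (BD G D) (graph_inner G) M \<and> Domain C = {x \<in> Domain A. boundary_trace x \<in> M}"
proof -
  have "{x \<in> Domain A. boundary_trace x \<in> M} = {(u, v). (u, v) \<in> Domain A \<and>
      (proj_BD G D u, app D (proj_BD D G v)) \<in> M}"
    unfolding boundary_trace_def by (auto simp: Domain_A)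
  then show ?thesis unfolding describes_BD_rel_def by simp
qed

text \<open>
  Every pair of boundary data is the trace of some vector, so membership in the relation can be read
  off from the domain of \<open>C\<close>.
\<close>

lemma boundary_relation_unique:
  assumes "describes_BD_rel G D C M" "describes_BD_rel G D C N"
  shows "M = N"
proof -
  have "M \<subseteq> N" if "describes_BD_rel G D C M" "describes_BD_rel G D C N" for M N
  proof
    fix p assume p: "p \<in> M"
    then have "p \<in> BD G D \<times> BD G D"
      using that(1) by (auto simp: describes_BD_rel_def m_accretive_on_def accretive_on_def)
    then obtain x where "x \<in> Domain A" "boundary_trace x = p"
      using boundary_trace_lift by blast
    then show "p \<in> N" using that p unfolding describes_BD_rel_iff by blast
  qed
  then show ?thesis using assms by blast
qed

text \<open>
  Accretivity is inherited through Green's formula. For the range condition, a solution \<open>x\<close> of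
  \<open>x + A x = g\<close> in the domain of \<open>A\<close> is corrected by a vector of the kernel of \<open>1 + A\<close> so that its
  trace lands in \<open>M\<close>.
\<close>

lemma describes_BD_rel_imp_m_accretive:
  assumes C: "C \<subseteq> A" and M: "describes_BD_rel G D C M"
  shows "m_accretive_on UNIV inner C"
  unfolding m_accretive_restriction_iff[OF C]
proof (intro conjI ballI allI)
  have dom: "x \<in> Domain C \<longleftrightarrow> x \<in> Domain A \<and> boundary_trace x \<in> M" for x
    using M unfolding describes_BD_rel_iff by blast
  have acc: "0 \<le> graph_inner G (v' - v) (u' - u)" if "(u, v) \<in> M" "(u', v') \<in> M" for u v u' v'
    using M that unfolding describes_BD_rel_iff m_accretive_on_def accretive_on_def by blast
  have onto: "\<exists>u v. (u, v) \<in> M \<and> u + v = b" if "b \<in> BD G D" for b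
    using M that unfolding describes_BD_rel_iff m_accretive_on_def by blast
  show "0 \<le> (app A x - app A y) \<bullet> (x - y)" if "x \<in> Domain C" "y \<in> Domain C" for x y
    using acc[of "fst (boundary_trace y)" "snd (boundary_trace y)"
        "fst (boundary_trace x)" "snd (boundary_trace x)"] that
    by (simp add: dom green_diff graph_inner_commute)
  show "\<exists>x\<in>Domain C. x + app A x = g" for g
  proof -
    obtain x where x: "x \<in> Domain A" "x + app A x = g" using one_plus_A_surj by blast
    obtain a b where ab: "boundary_trace x = (a, b)" by fastforce
    have BD: "a \<in> BD G D" "b \<in> BD G D" using boundary_trace_mem[OF x(1)] ab by auto
    \<comment> \<open>a correction by \<open>(w, - w)\<close> preserves the sum of the trace, so the target in \<open>M\<close> has this sum\<close>
    obtain u v where uv: "(u, v) \<in> M" "u + v = a + b"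
      using onto subspace_add[OF subspace_BD BD] by blast
    have "u \<in> BD G D"
      using M uv(1) unfolding describes_BD_rel_iff m_accretive_on_def accretive_on_def by blast
    define w where "w = a - u"
    have w: "w \<in> BD G D" unfolding w_def
      using BD \<open>u \<in> BD G D\<close> by (blast intro: subspace_diff subspace_BD)
    define k where "k = (w, - app G w)"
    have k: "k \<in> Domain A" "boundary_trace k = (w, - w)" "app A k = - k"
      using boundary_trace_eigenvector[OF w, of "-1"] app_A_antieigenvector[OF w]
      by (simp_all add: k_def)
    have v: "v = b + w" using uv(2) by (simp add: w_def algebra_simps)
    have "boundary_trace (x - k) = (u, v)"
      using boundary_trace_diff[OF x(1) k(1)] ab k(2) by (simp add: v w_def)
    moreover have "x - k \<in> Domain A"
      using x(1) k(1) subspace_diff[OF subspace_Domain[OF linear_A]] by blast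
    moreover have "(x - k) + app A (x - k) = g"
      using x k by (simp add: app_diff[OF linear_A] algebra_simps)
    ultimately show ?thesis using uv(1) dom[of "x - k"] by (intro bexI[of _ "x - k"]) simp_all
  qed
qed

text \<open>
  The relation has to be the set of all traces. What needs proof is that the domain of \<open>C\<close> contains
  every vector with such a trace (a form of maximality), and that sums of traces exhaust
  the boundary data.
\<close>

lemma m_accretive_imp_describes_BD_rel:
  assumes C: "C \<subseteq> A" and m: "m_accretive_on UNIV inner C"
  shows "describes_BD_rel G D C (boundary_trace ` Domain C)"
proof -
  have CA: "Domain C \<subseteq> Domain A" using C by blast
  have acc: "0 \<le> (app A x - app A y) \<bullet> (x - y)" if "x \<in> Domain C" "y \<in> Domain C" for x y
    using m that unfolding m_accretive_restriction_iff[OF C] by blast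
  have onto: "\<exists>x\<in>Domain C. x + app A x = g" for g
    using m unfolding m_accretive_restriction_iff[OF C] by blast
  \<comment> \<open>\<open>A (z - x) = - (z - x)\<close> makes the inner product both nonnegative and \<open>- (norm (z - x))\<^sup>2\<close>\<close>
  have max: "x \<in> Domain C"
    if x: "x \<in> Domain A" and y: "y \<in> Domain C" and xy: "boundary_trace x = boundary_trace y" for x y
  proof -
    obtain z where z: "z \<in> Domain C" "z + app A z = x + app A x" using onto by blast
    have "0 \<le> (app A z - app A y) \<bullet> (z - y)" using acc z(1) y .
    also have "\<dots> = (app A z - app A x) \<bullet> (z - x)"
      using green_diff[OF subsetD[OF CA z(1)] x] green_diff[OF subsetD[OF CA z(1)] subsetD[OF CA y]] xy
      by simp
    also have "app A z - app A x = - (z - x)"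
      using z(2) by (simp add: algebra_simps)
    finally have "(z - x) \<bullet> (z - x) \<le> 0" by (simp only: inner_minus_left neg_0_le_iff_le)
    then have "z - x = 0" by (metis inner_eq_zero_iff inner_ge_zero order_antisym)
    then have "z = x" by simp
    then show ?thesis using z(1) by simp
  qed
  \<comment> \<open>the vector \<open>(g, 0)\<close> has trace sum \<open>g\<close>, and a kernel vector of \<open>1 + A\<close> leads from it into the domain of \<open>C\<close>\<close>
  have "\<exists>p\<in>boundary_trace ` Domain C. fst p + snd p = g" if g: "g \<in> BD G D" for g
  proof -
    have x: "(g, 0) \<in> Domain A" "boundary_trace (g, 0) = (g, 0)"
      using boundary_trace_eigenvector[OF g, of 0] by simp_all
    obtain z where z: "z \<in> Domain C" "z + app A z = (g, 0) + app A (g, 0)" using onto by blast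
    have zA: "z \<in> Domain A" using z(1) CA by blast
    have "z - (g, 0) \<in> ker_one_plus A"
      using x(1) zA z(2) subspace_diff[OF subspace_Domain[OF linear_A] zA x(1)]
      by (simp add: ker_one_plus_def app_diff[OF linear_A] algebra_simps del: diff_Pair)
    then obtain w where w: "w \<in> BD G D" "z - (g, 0) = (w, - app G w)"
      unfolding ker_one_plus_A by blast
    then have "boundary_trace z - (g, 0) = (w, - w)"
      using boundary_trace_diff[OF zA x(1)] x(2) boundary_trace_eigenvector(2)[OF w(1), of "-1"]
      by simp
    then have "fst (boundary_trace z) + snd (boundary_trace z) = g"
      by (auto simp: prod_eq_iff algebra_simps)
    then show ?thesis using z(1) by blast
  qed
  moreover have "boundary_trace ` Domain C \<subseteq> BD G D \<times> BD G D"
    using boundary_trace_mem CA by blast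
  moreover have "0 \<le> graph_inner G (snd (boundary_trace y) - snd (boundary_trace x))
      (fst (boundary_trace y) - fst (boundary_trace x))" if "x \<in> Domain C" "y \<in> Domain C" for x y
    using acc[OF that(2,1)] green_diff[OF subsetD[OF CA that(2)] subsetD[OF CA that(1)]]
    by (simp add: graph_inner_commute)
  ultimately have "m_accretive_on (BD G D) (graph_inner G) (boundary_trace ` Domain C)"
    unfolding m_accretive_on_def accretive_on_def by (simp add: case_prod_unfold)
  moreover have "Domain C = {x \<in> Domain A. boundary_trace x \<in> boundary_trace ` Domain C}"
    using max CA by blast
  ultimately show ?thesis unfolding describes_BD_rel_iff by blast
qed

lemma describes_BD_map_iff_cayley_rel:
  "describes_BD_map G D C f \<longleftrightarrow>
    f \<in> BD G D \<rightarrow> BD G D \<and> describes_BD_rel G D C (cayley_rel (BD G D) f)"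
proof (cases "f \<in> BD G D \<rightarrow> BD G D")
  case True
  have "boundary_trace x \<in> cayley_rel (BD G D) f \<longleftrightarrow>
      f ((1/2) *\<^sub>R (proj_BD G D u + app D (proj_BD D G v)))
        = (1/2) *\<^sub>R (proj_BD G D u - app D (proj_BD D G v))"
    if "x \<in> Domain A" "x = (u, v)" for x u v
    using boundary_trace_mem[OF that(1)] mem_cayley_rel_iff[OF subspace_BD True]
    by (simp add: that(2) boundary_trace_def)
  then have "{x \<in> Domain A. boundary_trace x \<in> cayley_rel (BD G D) f} =
      {(u, v). (u, v) \<in> Domain A \<and> f ((1/2) *\<^sub>R (proj_BD G D u + app D (proj_BD D G v)))
        = (1/2) *\<^sub>R (proj_BD G D u - app D (proj_BD D G v))}"
    by blast
  then show ?thesis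
    using True m_accretive_cayley_rel_iff[OF linear_G subspace_BD BD_sub_Domain True]
    unfolding describes_BD_map_def describes_BD_rel_iff by simp
qed (simp add: describes_BD_map_def)

section \<open>Projections onto the eigenspaces of the operator matrix\<close>

text \<open>
  The cases \<open>c = 1\<close> and \<open>c = -1\<close> give the projections onto the kernels of \<open>1 - A\<close> and \<open>1 + A\<close>. An
  eigenvector has boundary data in both components, so its graph inner product with \<open>x\<close> depends
  only on the trace \<open>(a, b)\<close> of \<open>x\<close>; and an eigenvector over \<open>w\<close> has trace \<open>(w, c w)\<close>, so
  orthogonality of the difference to the eigenspace means \<open>a - w + c (b - c w) = 0\<close>.
\<close>

lemma orth_proj_eigenspace:
  assumes c: "c = 1 \<or> c = -1" and x: "x \<in> Domain A"
  defines "w \<equiv> (1/2) *\<^sub>R (fst (boundary_trace x) + c *\<^sub>R snd (boundary_trace x))"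
  shows "orth_proj (graph_inner A) ((\<lambda>w. (w, c *\<^sub>R app G w)) ` BD G D) x = (w, c *\<^sub>R app G w)"
    and "w \<in> BD G D"
proof -
  let ?K = "(\<lambda>w. (w, c *\<^sub>R app G w)) ` BD G D"
  show w: "w \<in> BD G D"
    using boundary_trace_mem[OF x] unfolding w_def mem_Times_iff
    by (blast intro: subspace_scale subspace_add subspace_BD)
  have inner: "graph_inner A y (s, c *\<^sub>R app G s)
      = graph_inner G (fst (boundary_trace y)) s + c * graph_inner G (snd (boundary_trace y)) s"
    if y: "y \<in> Domain A" and s: "s \<in> BD G D" for y s
  proof -
    have "app D (c *\<^sub>R app G s) = c *\<^sub>R s"
      using app_scale[OF linear_D subsetD[OF swap.BD_sub_Domain BD_swap(1)[OF s]]] BD_swap(2)[OF s]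
      by simp
    then have "graph_inner A y (s, c *\<^sub>R app G s)
        = graph_inner G (fst y) s + c * graph_inner D (snd y) (app G s)"
      using app_A[OF y] app_A[OF boundary_trace_eigenvector(1)[OF s]] BD_swap(2)[OF s]
      by (simp add: graph_inner_def inner_prod_def algebra_simps)
    also have "graph_inner G (fst y) s = graph_inner G (fst (boundary_trace y)) s"
      using graph_inner_proj_BD[OF Domain_A_D(1)[OF y] s] by (simp add: boundary_trace_def)
    also have "graph_inner D (snd y) (app G s) = graph_inner D (proj_BD D G (snd y)) (app G s)"
      by (rule swap.graph_inner_proj_BD[OF Domain_A_D(2)[OF y] BD_swap(1)[OF s]])
    also have "\<dots> = graph_inner G (snd (boundary_trace y)) s"
      using swap.BD_swap(2)[OF swap.proj_BD(1)[OF Domain_A_D(2)[OF y]]] BD_swap(2)[OF s]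
      by (simp add: graph_inner_def boundary_trace_def)
    finally show ?thesis .
  qed
  show "orth_proj (graph_inner A) ?K x = (w, c *\<^sub>R app G w)"
  proof (rule orth_proj_eqI[OF linear_A _ _ x])
    have "a \<in> Domain G" if "a \<in> BD G D" for a using that BD_sub_Domain by blast
    then have lin: "app G (a + b) = app G a + app G b" "app G (r *\<^sub>R a) = r *\<^sub>R app G a"
      if "a \<in> BD G D" "b \<in> BD G D" for a b r
      using that by (simp_all add: app_add[OF linear_G] app_scale[OF linear_G])
    show "subspace ?K"
      unfolding subspace_def
    proof (intro conjI ballI allI)
      have "0 \<in> BD G D" using subspace_0[OF subspace_BD] .
      moreover from lin(2)[OF this this, of 0] have "app G 0 = 0" by simp
      ultimately show "0 \<in> ?K" by (intro image_eqI[of _ _ 0]) (simp_all add: zero_prod_def)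
      show "p + q \<in> ?K" if pq: "p \<in> ?K" "q \<in> ?K" for p q
      proof -
        obtain a b where "a \<in> BD G D" "b \<in> BD G D" "p = (a, c *\<^sub>R app G a)" "q = (b, c *\<^sub>R app G b)"
          using pq by blast
        then show ?thesis
          using subspace_add[OF subspace_BD]
          by (intro image_eqI[of _ _ "a + b"]) (simp_all add: lin scaleR_add_right)
      qed
      show "r *\<^sub>R p \<in> ?K" if p: "p \<in> ?K" for r p
      proof -
        obtain a where "a \<in> BD G D" "p = (a, c *\<^sub>R app G a)" using p by blast
        then show ?thesis
          using subspace_scale[OF subspace_BD]
          by (intro image_eqI[of _ _ "r *\<^sub>R a"]) (simp_all add: lin)
      qed
    qed
    show "?K \<subseteq> Domain A" using boundary_trace_eigenvector(1) by blast
    show "(w, c *\<^sub>R app G w) \<in> ?K" using w by blast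
    fix k assume "k \<in> ?K"
    then obtain s where s: "s \<in> BD G D" "k = (s, c *\<^sub>R app G s)" by blast
    obtain a b where ab: "boundary_trace x = (a, b)" by fastforce
    have wA: "(w, c *\<^sub>R app G w) \<in> Domain A" using boundary_trace_eigenvector(1)[OF w] .
    have "graph_inner A (x - (w, c *\<^sub>R app G w)) k
        = graph_inner A x k - graph_inner A (w, c *\<^sub>R app G w) k"
      using app_diff[OF linear_A x wA] unfolding graph_inner_def by (simp only: inner_diff_left)
    also have "\<dots> = graph_inner G a s + c * graph_inner G b s
        - (graph_inner G w s + c * graph_inner G (c *\<^sub>R w) s)"
      unfolding s(2) inner[OF x s(1)] inner[OF wA s(1)] boundary_trace_eigenvector(2)[OF w] ab
      by simp
    also have "c * graph_inner G (c *\<^sub>R w) s = graph_inner G w s"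
      using c lin(2)[OF w w] by (auto simp: graph_inner_def)
    also have "graph_inner G w s = (1/2) * (graph_inner G a s + c * graph_inner G b s)"
    proof -
      have "a \<in> BD G D" "b \<in> BD G D" using boundary_trace_mem[OF x] ab by auto
      moreover from this have "c *\<^sub>R b \<in> BD G D" "a + c *\<^sub>R b \<in> BD G D"
        by (blast intro: subspace_scale subspace_add subspace_BD)+
      ultimately show ?thesis
        unfolding w_def ab by (simp add: graph_inner_def lin inner_add_left algebra_simps
            del: scaleR_add_right)
    qed
    finally show "graph_inner A (x - (w, c *\<^sub>R app G w)) k = 0" by simp
  qed
qed

text \<open>
  Both \<open>w \<mapsto> (w, G w)\<close> and \<open>w \<mapsto> (w, - G w)\<close> are isometric from the graph norm
  of \<open>G\<close> to the norm of the product space, so \<open>h\<close> is \<open>f\<close> in other coordinates, and the two Lipschitz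
  conditions agree.
\<close>

lemma describes_ker_iff_BD_map:
  assumes h: "\<And>w. w \<in> BD G D \<Longrightarrow> f w \<in> BD G D \<and> h (w, app G w) = (f w, - app G (f w))"
  shows "describes_ker A C h \<longleftrightarrow> describes_BD_map G D C f"
proof -
  have diff: "app G (x - y) = app G x - app G y" if "x \<in> BD G D" "y \<in> BD G D" for x y
    using that BD_sub_Domain by (blast intro: app_diff linear_G)
  have maps: "h \<in> ker_one_minus A \<rightarrow> ker_one_plus A" "f \<in> BD G D \<rightarrow> BD G D"
    unfolding ker_one_minus_A ker_one_plus_A using h by auto
  have iso: "norm (x - y, app G x - app G y) = graph_norm G (x - y)"
      "norm (x - y, app G y - app G x) = graph_norm G (x - y)"
    if "x \<in> BD G D" "y \<in> BD G D" for x y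
    using that by (simp_all add: graph_norm_eq_norm diff norm_Pair norm_minus_commute)
  have "lip_seminorm norm norm (ker_one_minus A) h \<le> 1 \<longleftrightarrow>
      lip_seminorm (graph_norm G) (graph_norm G) (BD G D) f \<le> 1"
    by (simp add: lip_seminorm_le_1_iff graph_norm_nonneg ker_one_minus_A h iso)
  moreover
  have "h (orth_proj (graph_inner A) (ker_one_minus A) (u, v))
        = orth_proj (graph_inner A) (ker_one_plus A) (u, v) \<longleftrightarrow>
      f ((1/2) *\<^sub>R (proj_BD G D u + app D (proj_BD D G v)))
        = (1/2) *\<^sub>R (proj_BD G D u - app D (proj_BD D G v))"
    if "(u, v) \<in> Domain A" for u v
    using orth_proj_eigenspace[of 1, OF _ that] orth_proj_eigenspace[of "-1", OF _ that] h
    by (auto simp: ker_one_minus_A ker_one_plus_A boundary_trace_def)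
  then have "{x \<in> Domain A. h (orth_proj (graph_inner A) (ker_one_minus A) x)
        = orth_proj (graph_inner A) (ker_one_plus A) x} =
      {(u, v). (u, v) \<in> Domain A \<and> f ((1/2) *\<^sub>R (proj_BD G D u + app D (proj_BD D G v)))
        = (1/2) *\<^sub>R (proj_BD G D u - app D (proj_BD D G v))}"
    by blast
  ultimately show ?thesis
    unfolding describes_ker_def describes_BD_map_def using maps by simp
qed

text \<open>
  A vector in the kernel of \<open>1 + A\<close> is determined by its first component, so the first component of
  \<open>h\<close> already determines \<open>h\<close>.
\<close>

lemma describes_ker_imp_BD_map:
  assumes "describes_ker A C h"
  shows "describes_BD_map G D C (\<lambda>w. fst (h (w, app G w)))"
proof -
  have "fst (h (w, app G w)) \<in> BD G D
      \<and> h (w, app G w) = (fst (h (w, app G w)), - app G (fst (h (w, app G w))))"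
    if "w \<in> BD G D" for w
  proof -
    have "h (w, app G w) \<in> ker_one_plus A"
      using assms that unfolding describes_ker_def ker_one_minus_A by blast
    then show ?thesis unfolding ker_one_plus_A by auto
  qed
  from describes_ker_iff_BD_map[of "\<lambda>w. fst (h (w, app G w))", OF this]
  show ?thesis using assms by blast
qed

lemma describes_BD_map_imp_ker:
  assumes "describes_BD_map G D C f"
  shows "describes_ker A C (\<lambda>x. (f (fst x), - app G (f (fst x))))"
  using describes_ker_iff_BD_map[of f "\<lambda>x. (f (fst x), - app G (f (fst x)))"] assms
  by (auto simp: describes_BD_map_def)

end

theorem theorem4p9:
  fixes G0 G :: "('a::{real_inner,complete_space} \<times> 'b::{real_inner,complete_space}) set"
    and D0 D :: "('b \<times> 'a) set"
    and A C :: "(('a \<times> 'b) \<times> ('a \<times> 'b)) set"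
  assumes "linear_op G0" "closed G0" "densely_defined G0"
    and "linear_op D0" "closed D0" "densely_defined D0"
    and "G = neg_op (adjoint_op D0)" "G0 \<subseteq> G"
    and "D = neg_op (adjoint_op G0)" "D0 \<subseteq> D"
    and "A = block_op D G"
    and "C \<subseteq> A"
  shows "(m_accretive_on UNIV inner C \<longleftrightarrow> (\<exists>h. describes_ker A C h))
       \<and> (m_accretive_on UNIV inner C \<longleftrightarrow> (\<exists>f. describes_BD_map G D C f))
       \<and> (m_accretive_on UNIV inner C \<longleftrightarrow> (\<exists>M. describes_BD_rel G D C M))
       \<and> (\<forall>h f M. describes_ker A C h \<and> describes_BD_map G D C f \<and> describes_BD_rel G D C M \<longrightarrow>
            (\<forall>u \<in> BD G D. f u = fst (h (u, app G u))) \<and> M = cayley_rel (BD G D) f)"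
proof -
  interpret boundary_pair G0 G D0 D
    using assms(1-10) by unfold_locales
  have C: "C \<subseteq> block_op D G" using assms(11,12) by simp
  have i_iv: "m_accretive_on UNIV inner C \<longleftrightarrow> (\<exists>M. describes_BD_rel G D C M)"
    using describes_BD_rel_imp_m_accretive[OF C] m_accretive_imp_describes_BD_rel[OF C] by blast
  have iii_iv: "(\<exists>f. describes_BD_map G D C f) \<longleftrightarrow> (\<exists>M. describes_BD_rel G D C M)"
    using m_accretive_imp_cayley_rel[OF linear_G subspace_BD BD_sub_Domain]
    unfolding describes_BD_map_iff_cayley_rel by (metis describes_BD_rel_def)
  have ii_iii: "(\<exists>h. describes_ker A C h) \<longleftrightarrow> (\<exists>f. describes_BD_map G D C f)"
    unfolding assms(11) using describes_ker_imp_BD_map describes_BD_map_imp_ker by blast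
  have "(\<forall>u \<in> BD G D. f u = fst (h (u, app G u))) \<and> M = cayley_rel (BD G D) f"
    if h: "describes_ker A C h" and f: "describes_BD_map G D C f" and M: "describes_BD_rel G D C M"
    for h f M
  proof -
    \<comment> \<open>\<open>f\<close> and the first component of \<open>h\<close> both describe \<open>C\<close>, hence have the same Cayley relation\<close>
    have h': "describes_BD_map G D C (\<lambda>u. fst (h (u, app G u)))"
      using h describes_ker_imp_BD_map unfolding assms(11) by blast
    have eq: "M = cayley_rel (BD G D) g" if "describes_BD_map G D C g" for g
      using that M boundary_relation_unique unfolding describes_BD_map_iff_cayley_rel by blast
    have "cayley_rel (BD G D) f = cayley_rel (BD G D) (\<lambda>u. fst (h (u, app G u)))"
      using eq[OF f] eq[OF h'] by simp
    then have "f u = fst (h (u, app G u))" if "u \<in> BD G D" for u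
      using cayley_rel_inj[OF subspace_BD _ _ _ that, of f "\<lambda>u. fst (h (u, app G u))"] f h'
      unfolding describes_BD_map_def by blast
    then show ?thesis using eq[OF f] by blast
  qed
  with i_iv iii_iv ii_iii show ?thesis by blast
qed

end
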